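(* Let a consistent class of data with family $\{\mathfrak E_x\}_{x\in X}$, topologies $\{\tau_x\}_{x\in X}$, space $\langle\mathcal H,\mathfrak T\rangle$ and linear space $\mathcal A$ be given, and let $\mathfrak G$ be the locally convex space relative to it (see context). Let $D\subseteq\mathcal H$. Then (A) implies (B), where (A) for all $x\in X$ and all $v_x\in\Pr_x(D)$ the evaluation map $\mathcal L(\mathfrak E_x)\ni f\mapsto f(v_x)\in\mathfrak E_x$ is continuous from $\langle\mathcal L(\mathfrak E_x),\tau_x\rangle$ to $\mathfrak E_x$; (B) for all $v\in D$ the evaluation map $\mathfrak G\ni g\mapsto g(v)\in\mathcal H$ is continuous from $\mathfrak G$ to $\langle\mathcal H,\mathfrak T\rangle$.
   Context: Hlcs means Hausdorff locally convex space (over $\mathbb C$); $\mathcal L(E)$ denotes the continuous, $End(E)$ all linear endomorphisms of $E$. For a family of vector spaces $\{Z_x\}_{x\in X}$, $\Pr_x:\prod_yZ_y\to Z_x$ is the projection and $\imath_x:Z_x\to\prod_yZ_y$ the canonical injection (zero in all other coordinates). Consistent class of data: a set $X$, a locally compact space $Y$ with a Radon measure $\mu$, Hlcs $\mathfrak E_x$ ($x\in X$) with fundamental sets of seminorms, topologies $\tau_x$ making $\langle\mathcal L(\mathfrak E_x),\tau_x\rangle$ a Hlcs (with fundamental sets of seminorms), and a Hlcs $\langle\mathcal H,\mathfrak T\rangle$ such that: $\mathcal H$ is a linear subspace of $\prod_x\mathfrak E_x$; $\imath_x(\mathfrak E_x)\subset\mathcal H$ for all $x$; $\Pr_x:\langle\mathcal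 H,\mathfrak T\rangle\to\mathfrak E_x$ and $\imath_x:\mathfrak E_x\to\langle\mathcal H,\mathfrak T\rangle$ are continuous for all $x$; and $\mathcal A\subseteq\prod_x\mathcal L(\mathfrak E_x)$ is a linear subspace with $\theta(u)|_{\mathcal H}\in\mathcal L(\langle\mathcal H,\mathfrak T\rangle)$ for all $u\in\mathcal A$ and $\imath_x(\mathcal L(\mathfrak E_x))\subseteq\mathcal A$ for all $x$. Here $\theta:\prod_xEnd(\mathfrak E_x)\to End(\prod_x\mathfrak E_x)$ is given by $\Pr_x\circ\theta(u)=\Pr_x(u)\circ\Pr_x$. $\mathfrak G$ is the vector space $G=\{\theta(u)|_{\mathcal H}:u\in\mathcal A\}$ with the locally convex final topology (finest locally convex topology) making all maps $h_x:\langle\mathcal L(\mathfrak E_x),\tau_x\rangle\to G$, $h_x(f)=(\imath_x\circ f\circ\Pr_x)|_{\mathcal H}$, $x\in X$, continuous. *)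

theory Defs
  imports "HOL-Analysis.Analysis" "HOL-Algebra.Module"
begin

text \<open>
  Complex vector spaces are modules over the following ring, so that the members of a family
  \<open>E x\<close> need not share their operations. The fields \<open>mult\<close> and \<open>one\<close> of a module record
  carry no meaning and are left unspecified below.
\<close>

definition complex_ring :: "complex ring" where
  "complex_ring = \<lparr>carrier = UNIV, mult = (*), one = 1, zero = 0, add = (+)\<rparr>"

abbreviation cvector_space :: "(complex, 'a) module \<Rightarrow> bool" where
  "cvector_space V \<equiv> Module.module complex_ring V"

abbreviation csubspace :: "'a set \<Rightarrow> (complex, 'a) module \<Rightarrow> bool" where
  "csubspace S V \<equiv> submodule S complex_ring V"

definition convex_in :: "(complex, 'a) module \<Rightarrow> 'a set \<Rightarrow> bool" where
  "convex_in V S \<longleftrightarrow>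
     S \<subseteq> carrier V \<and>
     (\<forall>a\<in>S. \<forall>b\<in>S. \<forall>t::real. 0 \<le> t \<and> t \<le> 1 \<longrightarrow>
        (complex_of_real t \<odot>\<^bsub>V\<^esub> a) \<oplus>\<^bsub>V\<^esub> (complex_of_real (1 - t) \<odot>\<^bsub>V\<^esub> b) \<in> S)"

text \<open>Topological vector spaces in which the convex neighbourhoods of zero are a basis
  of neighbourhoods of zero.\<close>

definition lc_space :: "(complex, 'a) module \<Rightarrow> 'a topology \<Rightarrow> bool" where
  "lc_space V T \<longleftrightarrow>
     cvector_space V \<and>
     topspace T = carrier V \<and>
     continuous_map (prod_topology T T) T (\<lambda>(a, b). a \<oplus>\<^bsub>V\<^esub> b) \<and>
     continuous_map (prod_topology euclidean T) T (\<lambda>(c, a). c \<odot>\<^bsub>V\<^esub> a) \<and>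
     (\<forall>U. openin T U \<and> \<zero>\<^bsub>V\<^esub> \<in> U \<longrightarrow>
        (\<exists>N W. openin T N \<and> \<zero>\<^bsub>V\<^esub> \<in> N \<and> N \<subseteq> W \<and> W \<subseteq> U \<and> convex_in V W))"

definition hlc_space :: "(complex, 'a) module \<Rightarrow> 'a topology \<Rightarrow> bool" where
  "hlc_space V T \<longleftrightarrow> lc_space V T \<and> Hausdorff_space T"

definition seminorm_on :: "(complex, 'a) module \<Rightarrow> ('a \<Rightarrow> real) \<Rightarrow> bool" where
  "seminorm_on V p \<longleftrightarrow>
     (\<forall>a\<in>carrier V. 0 \<le> p a) \<and>
     (\<forall>a\<in>carrier V. \<forall>b\<in>carrier V. p (a \<oplus>\<^bsub>V\<^esub> b) \<le> p a + p b) \<and>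
     (\<forall>c. \<forall>a\<in>carrier V. p (c \<odot>\<^bsub>V\<^esub> a) = cmod c * p a)"

text \<open>A set of seminorms is fundamental if it defines the topology; it need not be directed.\<close>

definition fundamental_seminorms ::
  "(complex, 'a) module \<Rightarrow> 'a topology \<Rightarrow> ('a \<Rightarrow> real) set \<Rightarrow> bool" where
  "fundamental_seminorms V T P \<longleftrightarrow>
     (\<forall>p\<in>P. seminorm_on V p) \<and>
     (\<forall>U. openin T U \<longleftrightarrow>
        U \<subseteq> carrier V \<and>
        (\<forall>a\<in>U. \<exists>F e. finite F \<and> F \<subseteq> P \<and> 0 < e \<and>
           {b \<in> carrier V. \<forall>p\<in>F. p (b \<ominus>\<^bsub>V\<^esub> a) < e} \<subseteq> U))"

definition product_space ::
  "'x set \<Rightarrow> ('x \<Rightarrow> (complex, 'a) module) \<Rightarrow> (complex, 'x \<Rightarrow> 'a) module" where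
  "product_space X Z =
     \<lparr>carrier = (\<Pi>\<^sub>E x\<in>X. carrier (Z x)), mult = undefined, one = undefined,
      zero = (\<lambda>x\<in>X. \<zero>\<^bsub>Z x\<^esub>),
      add = (\<lambda>u v. \<lambda>x\<in>X. u x \<oplus>\<^bsub>Z x\<^esub> v x),
      smult = (\<lambda>c u. \<lambda>x\<in>X. c \<odot>\<^bsub>Z x\<^esub> u x)\<rparr>"

definition Pr :: "'x \<Rightarrow> ('x \<Rightarrow> 'a) \<Rightarrow> 'a" where
  "Pr x u = u x"

definition can_inj ::
  "'x set \<Rightarrow> ('x \<Rightarrow> (complex, 'a) module) \<Rightarrow> 'x \<Rightarrow> 'a \<Rightarrow> ('x \<Rightarrow> 'a)" where
  "can_inj X Z x a = (\<lambda>y\<in>X. if y = x then a else \<zero>\<^bsub>Z y\<^esub>)"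

text \<open>All linear endomorphisms; outside the carrier their value is fixed to be \<open>undefined\<close>.\<close>

definition End_space :: "(complex, 'a) module \<Rightarrow> (complex, 'a \<Rightarrow> 'a) module" where
  "End_space V =
     \<lparr>carrier = {f \<in> carrier V \<rightarrow>\<^sub>E carrier V.
         (\<forall>a\<in>carrier V. \<forall>b\<in>carrier V. f (a \<oplus>\<^bsub>V\<^esub> b) = f a \<oplus>\<^bsub>V\<^esub> f b) \<and>
         (\<forall>c. \<forall>a\<in>carrier V. f (c \<odot>\<^bsub>V\<^esub> a) = c \<odot>\<^bsub>V\<^esub> f a)},
      mult = undefined, one = undefined,
      zero = (\<lambda>a\<in>carrier V. \<zero>\<^bsub>V\<^esub>),
      add = (\<lambda>f g. \<lambda>a\<in>carrier V. f a \<oplus>\<^bsub>V\<^esub> g a),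
      smult = (\<lambda>c f. \<lambda>a\<in>carrier V. c \<odot>\<^bsub>V\<^esub> f a)\<rparr>"

definition L_space :: "(complex, 'a) module \<Rightarrow> 'a topology \<Rightarrow> (complex, 'a \<Rightarrow> 'a) module" where
  "L_space V T =
     (End_space V)\<lparr>carrier := {f \<in> carrier (End_space V). continuous_map T T f}\<rparr>"

definition theta ::
  "'x set \<Rightarrow> ('x \<Rightarrow> (complex, 'a) module) \<Rightarrow> ('x \<Rightarrow> 'a \<Rightarrow> 'a) \<Rightarrow> ('x \<Rightarrow> 'a) \<Rightarrow> ('x \<Rightarrow> 'a)" where
  "theta X E u = (\<lambda>w\<in>carrier (product_space X E). \<lambda>x\<in>X. Pr x u (Pr x w))"

text \<open>
  Radon measures in the sense of Bourbaki: linear forms on the space of continuous complex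
  functions with compact support that are bounded, for the supremum norm, on the functions
  supported in any given compact set. Test functions are extended by zero outside \<open>topspace Y\<close>.
\<close>

definition Cc_on :: "'y topology \<Rightarrow> 'y set \<Rightarrow> ('y \<Rightarrow> complex) set" where
  "Cc_on Y K = {f. continuous_map Y euclidean f \<and> (\<forall>y. y \<notin> K \<longrightarrow> f y = 0)}"

definition Cc :: "'y topology \<Rightarrow> ('y \<Rightarrow> complex) set" where
  "Cc Y = (\<Union>K\<in>{K. compactin Y K}. Cc_on Y K)"

definition radon_measure :: "'y topology \<Rightarrow> (('y \<Rightarrow> complex) \<Rightarrow> complex) \<Rightarrow> bool" where
  "radon_measure Y \<mu> \<longleftrightarrow>
     (\<forall>f\<in>Cc Y. \<forall>g\<in>Cc Y. \<mu> (\<lambda>y. f y + g y) = \<mu> f + \<mu> g) \<and>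
     (\<forall>c. \<forall>f\<in>Cc Y. \<mu> (\<lambda>y. c * f y) = c * \<mu> f) \<and>
     (\<forall>K. compactin Y K \<longrightarrow>
        (\<exists>M. \<forall>f\<in>Cc_on Y K. \<forall>B. (\<forall>y. cmod (f y) \<le> B) \<longrightarrow> cmod (\<mu> f) \<le> M * B))"

text \<open>
  \<open>TE x\<close>, \<open>\<tau> x\<close> and \<open>TH\<close> are the topologies of \<open>E x\<close>, of the space of continuous endomorphisms
  of \<open>E x\<close>, and of \<open>H\<close>; \<open>PE x\<close> and \<open>PL x\<close> are the sets of seminorms of the first two.
\<close>

locale consistent_data =
  fixes X :: "'x set"
    and Y :: "'y topology"
    and \<mu> :: "('y \<Rightarrow> complex) \<Rightarrow> complex"
    and E :: "'x \<Rightarrow> (complex, 'e) module"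
    and TE :: "'x \<Rightarrow> 'e topology"
    and PE :: "'x \<Rightarrow> ('e \<Rightarrow> real) set"
    and \<tau> :: "'x \<Rightarrow> ('e \<Rightarrow> 'e) topology"
    and PL :: "'x \<Rightarrow> (('e \<Rightarrow> 'e) \<Rightarrow> real) set"
    and H :: "('x \<Rightarrow> 'e) set"
    and TH :: "('x \<Rightarrow> 'e) topology"
    and A :: "('x \<Rightarrow> 'e \<Rightarrow> 'e) set"
  assumes Y_locally_compact: "locally_compact_space Y" "Hausdorff_space Y"
    and mu_radon: "radon_measure Y \<mu>"
    and E_hlcs: "\<And>x. x \<in> X \<Longrightarrow> hlc_space (E x) (TE x)"
    and E_seminorms: "\<And>x. x \<in> X \<Longrightarrow> fundamental_seminorms (E x) (TE x) (PE x)"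
    and L_hlcs: "\<And>x. x \<in> X \<Longrightarrow> hlc_space (L_space (E x) (TE x)) (\<tau> x)"
    and L_seminorms:
      "\<And>x. x \<in> X \<Longrightarrow> fundamental_seminorms (L_space (E x) (TE x)) (\<tau> x) (PL x)"
    and H_subspace: "csubspace H (product_space X E)"
    and H_hlcs: "hlc_space ((product_space X E)\<lparr>carrier := H\<rparr>) TH"
    and inj_in_H: "\<And>x. x \<in> X \<Longrightarrow> can_inj X E x ` carrier (E x) \<subseteq> H"
    and Pr_continuous: "\<And>x. x \<in> X \<Longrightarrow> continuous_map TH (TE x) (Pr x)"
    and inj_continuous: "\<And>x. x \<in> X \<Longrightarrow> continuous_map (TE x) TH (can_inj X E x)"
    and A_subspace: "csubspace A (product_space X (\<lambda>x. L_space (E x) (TE x)))"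
    and theta_A: "\<And>u. u \<in> A \<Longrightarrow>
      restrict (theta X E u) H \<in> carrier (L_space ((product_space X E)\<lparr>carrier := H\<rparr>) TH)"
    and inj_in_A: "\<And>x. x \<in> X \<Longrightarrow>
      can_inj X (\<lambda>x. L_space (E x) (TE x)) x ` carrier (L_space (E x) (TE x)) \<subseteq> A"

definition G_space ::
  "'x set \<Rightarrow> ('x \<Rightarrow> (complex, 'e) module) \<Rightarrow> ('x \<Rightarrow> 'e) set \<Rightarrow> ('x \<Rightarrow> 'e \<Rightarrow> 'e) set \<Rightarrow>
   (complex, ('x \<Rightarrow> 'e) \<Rightarrow> ('x \<Rightarrow> 'e)) module" where
  "G_space X E H A =
     (End_space ((product_space X E)\<lparr>carrier := H\<rparr>))
       \<lparr>carrier := {restrict (theta X E u) H | u. u \<in> A}\<rparr>"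

definition h_map ::
  "'x set \<Rightarrow> ('x \<Rightarrow> (complex, 'e) module) \<Rightarrow> ('x \<Rightarrow> 'e) set \<Rightarrow> 'x \<Rightarrow> ('e \<Rightarrow> 'e) \<Rightarrow>
   ('x \<Rightarrow> 'e) \<Rightarrow> ('x \<Rightarrow> 'e)" where
  "h_map X E H x f = restrict (can_inj X E x \<circ> f \<circ> Pr x) H"

text \<open>\<open>T\<close> is the finest topology such that \<open>lc_space V T\<close> and every \<open>h i\<close> is continuous.\<close>

definition is_final_lc_topology ::
  "'i set \<Rightarrow> ('i \<Rightarrow> 'b topology) \<Rightarrow> (complex, 'a) module \<Rightarrow> ('i \<Rightarrow> 'b \<Rightarrow> 'a) \<Rightarrow>
   'a topology \<Rightarrow> bool" where
  "is_final_lc_topology I S V h T \<longleftrightarrow>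
     lc_space V T \<and>
     (\<forall>i\<in>I. continuous_map (S i) T (h i)) \<and>
     (\<forall>T'. lc_space V T' \<and> (\<forall>i\<in>I. continuous_map (S i) T' (h i)) \<longrightarrow>
        (\<forall>U. openin T' U \<longrightarrow> openin T U))"

lemma ex1_final_lc_topology:
  assumes V: "cvector_space V"
    and h: "\<And>i. i \<in> I \<Longrightarrow> h i ` topspace (S i) \<subseteq> carrier V"
  shows "\<exists>!T. is_final_lc_topology I S V h T"
proof -
  interpret Module.module complex_ring V by (rule V)
  define TT where "TT = {T. lc_space V T \<and> (\<forall>i\<in>I. continuous_map (S i) T (h i))}"
  define gen where "gen = insert (carrier V) {U. \<exists>T\<in>TT. openin T U}"
  define T0 where "T0 = topology_generated_by gen"
  have tops: "topspace T = carrier V" if "T \<in> TT" for T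
    using that by (auto simp: TT_def lc_space_def)
  have Ugen: "\<Union>gen = carrier V"
    using tops openin_subset by (fastforce simp: gen_def)
  have top0: "topspace T0 = carrier V"
    by (simp add: T0_def Ugen)
  have finer: "openin T0 U" if "T \<in> TT" "openin T U" for T U
    unfolding T0_def by (rule topology_generated_by_Basis) (use that in \<open>auto simp: gen_def\<close>)
  have into: "continuous_map R T0 f"
    if "\<And>T. T \<in> TT \<Longrightarrow> continuous_map R T f" "f ` topspace R \<subseteq> carrier V"
    for R :: "'r topology" and f
    unfolding T0_def
  proof (rule continuous_on_generated_topo)
    fix U assume "U \<in> gen"
    then consider "U = carrier V" | T where "T \<in> TT" "openin T U" by (auto simp: gen_def)
    then show "openin R (f -` U \<inter> topspace R)"
    proof cases
      case 1
      then have "f -` U \<inter> topspace R = topspace R" using that(2) by auto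
      then show ?thesis by simp
    next
      case 2
      then show ?thesis
        using that(1)[of T] by (auto simp: continuous_map_alt)
    qed
  qed (use that Ugen in auto)
  have idc: "continuous_map T0 T (\<lambda>a. a)" if "T \<in> TT" for T
    using that finer tops top0 openin_subset by (fastforce simp: continuous_map_def
        intro: openin_subopen[THEN iffD2])
  have add: "continuous_map (prod_topology T0 T0) T0 (\<lambda>(a, b). a \<oplus>\<^bsub>V\<^esub> b)"
  proof (rule into)
    fix T assume T: "T \<in> TT"
    have "continuous_map (prod_topology T0 T0) (prod_topology T T) (\<lambda>z. (fst z, snd z))"
      using idc[OF T] by (intro continuous_map_pairedI)
        (auto intro: continuous_map_compose[unfolded o_def, OF continuous_map_fst]
          continuous_map_compose[unfolded o_def, OF continuous_map_snd])
    moreover have "continuous_map (prod_topology T T) T (\<lambda>(a, b). a \<oplus>\<^bsub>V\<^esub> b)"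
      using T by (simp add: TT_def lc_space_def)
    ultimately show "continuous_map (prod_topology T0 T0) T (\<lambda>(a, b). a \<oplus>\<^bsub>V\<^esub> b)"
      using continuous_map_compose by (fastforce simp: o_def)
  qed (auto simp: top0)
  have scl: "continuous_map (prod_topology euclidean T0) T0 (\<lambda>(c, a). c \<odot>\<^bsub>V\<^esub> a)"
  proof (rule into)
    fix T assume T: "T \<in> TT"
    have "continuous_map (prod_topology euclidean T0) (prod_topology euclidean T)
        (\<lambda>z. (fst z, snd z))"
      using idc[OF T] by (intro continuous_map_pairedI)
        (auto intro: continuous_map_fst
          continuous_map_compose[unfolded o_def, OF continuous_map_snd])
    moreover have "continuous_map (prod_topology euclidean T) T (\<lambda>(c, a). c \<odot>\<^bsub>V\<^esub> a)"
      using T by (simp add: TT_def lc_space_def)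
    ultimately show "continuous_map (prod_topology euclidean T0) T (\<lambda>(c, a). c \<odot>\<^bsub>V\<^esub> a)"
      using continuous_map_compose by (fastforce simp: o_def)
  qed (auto simp: top0 complex_ring_def)
  have cvx: "\<exists>N W. openin T0 N \<and> \<zero>\<^bsub>V\<^esub> \<in> N \<and> N \<subseteq> W \<and> W \<subseteq> U \<and> convex_in V W"
    if "openin T0 U" "\<zero>\<^bsub>V\<^esub> \<in> U" for U
  proof -
    have "generate_topology_on gen U"
      using that by (simp add: T0_def openin_topology_generated_by_iff)
    then show ?thesis using that(2)
    proof (induction rule: generate_topology_on.induct)
      case (Int a b)
      then obtain N W N' W' where
        "openin T0 N" "\<zero>\<^bsub>V\<^esub> \<in> N" "N \<subseteq> W" "W \<subseteq> a" "convex_in V W"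
        "openin T0 N'" "\<zero>\<^bsub>V\<^esub> \<in> N'" "N' \<subseteq> W'" "W' \<subseteq> b" "convex_in V W'"
        by (metis IntE)
      then show ?case
        by (intro exI[of _ "N \<inter> N'"] exI[of _ "W \<inter> W'"]) (auto simp: convex_in_def)
    next
      case (UN K)
      then show ?case by (meson Union_iff Union_upper order_trans)
    next
      case (Basis U)
      then consider "U = carrier V" | T where "T \<in> TT" "openin T U" by (auto simp: gen_def)
      then show ?case
      proof cases
        case 1
        have "openin T0 (carrier V)" using openin_topspace[of T0] by (simp add: top0)
        moreover have "convex_in V (carrier V)"
          by (auto simp: convex_in_def complex_ring_def)
        ultimately show ?thesis using 1 Basis by blast
      next
        case 2
        then have "lc_space V T" by (simp add: TT_def)
        then show ?thesis using 2 Basis finer[OF 2(1)] unfolding lc_space_def by meson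
      qed
    qed simp
  qed
  have "is_final_lc_topology I S V h T0"
    unfolding is_final_lc_topology_def
  proof (intro conjI allI impI ballI)
    show "lc_space V T0" unfolding lc_space_def using V top0 add scl cvx by blast
  next
    fix i assume "i \<in> I"
    then show "continuous_map (S i) T0 (h i)"
      by (intro into) (use h in \<open>auto simp: TT_def\<close>)
  next
    fix T' U assume "lc_space V T' \<and> (\<forall>i\<in>I. continuous_map (S i) T' (h i))" "openin T' U"
    then show "openin T0 U" using finer[of T' U] by (simp add: TT_def)
  qed
  moreover have "T = T'" if "is_final_lc_topology I S V h T" "is_final_lc_topology I S V h T'" for T T'
    using that unfolding is_final_lc_topology_def topology_eq by blast
  ultimately show ?thesis by blast
qed

lemma End_space_vector_space:
  assumes "cvector_space V"
  shows "cvector_space (End_space V)"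
proof -
  interpret V: Module.module complex_ring V by (rule assms)
  note cl = V.smult_closed[unfolded complex_ring_def, simplified]
  have neg: "(- 1) \<odot>\<^bsub>V\<^esub> x \<oplus>\<^bsub>V\<^esub> x = \<zero>\<^bsub>V\<^esub>" if "x \<in> carrier V" for x
    using V.smult_l_distr[of "- 1" 1 x] V.smult_one[of x] V.smult_l_null[of x] that
    by (simp add: complex_ring_def)
  note ds = V.smult_l_distr[unfolded complex_ring_def, simplified]
    V.smult_r_distr[unfolded complex_ring_def, simplified]
    V.smult_assoc1[unfolded complex_ring_def, simplified]
    V.smult_one[unfolded complex_ring_def, simplified]
  have smult: "(\<lambda>a\<in>carrier V. c \<odot>\<^bsub>V\<^esub> f a) \<in> carrier (End_space V)"
    if "f \<in> carrier (End_space V)" for c f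
    using that
    by (auto simp: End_space_def PiE_iff cl ds V.a_closed mult.commute simp flip: ds(3))
  show ?thesis
  proof (rule moduleI)
    show "cring complex_ring" by (rule V.R.cring_axioms)
    show "abelian_group (End_space V)"
    proof (rule abelian_groupI)
      fix f assume f: "f \<in> carrier (End_space V)"
      have "(\<lambda>a\<in>carrier V. (- 1) \<odot>\<^bsub>V\<^esub> f a) \<oplus>\<^bsub>End_space V\<^esub> f = \<zero>\<^bsub>End_space V\<^esub>"
        using f by (auto simp: End_space_def fun_eq_iff neg PiE_iff)
      then show "\<exists>g\<in>carrier (End_space V). g \<oplus>\<^bsub>End_space V\<^esub> f = \<zero>\<^bsub>End_space V\<^esub>"
        using smult[OF f] by blast
    next
      fix f g assume "f \<in> carrier (End_space V)" "g \<in> carrier (End_space V)"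
      then show "f \<oplus>\<^bsub>End_space V\<^esub> g \<in> carrier (End_space V)"
        by (auto simp: End_space_def PiE_iff cl ds V.a_ac)
    next
      show "\<zero>\<^bsub>End_space V\<^esub> \<in> carrier (End_space V)"
        using V.smult_r_null by (auto simp: End_space_def complex_ring_def cl)
    qed (auto simp: End_space_def PiE_iff fun_eq_iff V.a_ac extensional_def)
  next
    fix c f assume "f \<in> carrier (End_space V)"
    then show "c \<odot>\<^bsub>End_space V\<^esub> f \<in> carrier (End_space V)"
      using smult[of f c] by (simp add: End_space_def)
  qed (auto simp: End_space_def PiE_iff fun_eq_iff extensional_def complex_ring_def ds cl)
qed

context consistent_data
begin

abbreviation "HV \<equiv> (product_space X E)\<lparr>carrier := H\<rparr>"

lemma G_vector_space: "cvector_space (G_space X E H A)"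
proof -
  have HV: "cvector_space HV" using H_hlcs by (simp add: hlc_space_def lc_space_def)
  interpret EV: Module.module complex_ring "End_space HV"
    by (rule End_space_vector_space[OF HV])
  let ?LP = "product_space X (\<lambda>x. L_space (E x) (TE x))"
  have Hsub: "H \<subseteq> carrier (product_space X E)"
    using H_subspace by (simp add: submodule_def subgroup_def)
  have Ap: "A \<subseteq> carrier ?LP" using A_subspace by (simp add: submodule_def subgroup_def)
  have Aadd: "u \<oplus>\<^bsub>?LP\<^esub> v \<in> A" if "u \<in> A" "v \<in> A" for u v
    using A_subspace that by (auto simp: submodule_def subgroup_def)
  have Asm: "c \<odot>\<^bsub>?LP\<^esub> u \<in> A" if "u \<in> A" for c u
    using submodule.smult_closed[OF A_subspace] that by (simp add: complex_ring_def)
  have Hx: "w x \<in> carrier (E x)" if "w \<in> H" "x \<in> X" for w x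
    using Hsub that by (auto simp: product_space_def)
  let ?G = "{restrict (theta X E u) H | u. u \<in> A}"
  have add: "restrict (theta X E (u \<oplus>\<^bsub>?LP\<^esub> v)) H =
      restrict (theta X E u) H \<oplus>\<^bsub>End_space HV\<^esub> restrict (theta X E v) H" for u v
    using Hsub Hx by (auto simp: End_space_def product_space_def theta_def Pr_def L_space_def
        fun_eq_iff restrict_def)
  have sm: "restrict (theta X E (c \<odot>\<^bsub>?LP\<^esub> u)) H =
      c \<odot>\<^bsub>End_space HV\<^esub> restrict (theta X E u) H" for c u
    using Hsub Hx by (auto simp: End_space_def product_space_def theta_def Pr_def L_space_def
        fun_eq_iff restrict_def)
  have Gsub: "?G \<subseteq> carrier (End_space HV)"
    using theta_A by (auto simp: L_space_def)
  have Gsm: "c \<odot>\<^bsub>End_space HV\<^esub> g \<in> ?G" if "g \<in> ?G" for c g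
    using that Asm sm[symmetric] by auto
  have neg: "\<ominus>\<^bsub>End_space HV\<^esub> g = (- 1) \<odot>\<^bsub>End_space HV\<^esub> g"
    if "g \<in> carrier (End_space HV)" for g
  proof -
    have "\<ominus>\<^bsub>complex_ring\<^esub> (1::complex) = - 1"
      by (rule EV.R.minus_equality) (auto simp: complex_ring_def)
    then show ?thesis
      using EV.smult_l_minus[of 1 g] EV.smult_one[OF that] that by (simp add: complex_ring_def)
  qed
  have "submodule ?G complex_ring (End_space HV)"
  proof (rule EV.submoduleI)
    have "\<zero>\<^bsub>?LP\<^esub> \<in> A" using A_subspace by (auto simp: submodule_def subgroup_def)
    then have "restrict (theta X E \<zero>\<^bsub>?LP\<^esub>) H \<in> ?G" by blast
    moreover have "restrict (theta X E \<zero>\<^bsub>?LP\<^esub>) H = \<zero>\<^bsub>End_space HV\<^esub>"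
      using Hsub Hx by (auto simp: End_space_def product_space_def theta_def Pr_def L_space_def
        fun_eq_iff restrict_def)
    ultimately show "\<zero>\<^bsub>End_space HV\<^esub> \<in> ?G" by simp
    show "\<ominus>\<^bsub>End_space HV\<^esub> g \<in> ?G" if "g \<in> ?G" for g
      using neg[of g] Gsm[OF that] Gsub that by auto
    show "g \<oplus>\<^bsub>End_space HV\<^esub> k \<in> ?G" if "g \<in> ?G" "k \<in> ?G" for g k
      using that Aadd add[symmetric] by auto
  qed (use Gsub Gsm in auto)
  then show ?thesis
    using submodule.submodule_is_module EV.module_axioms by (fastforce simp: G_space_def)
qed

lemma h_map_in_G:
  assumes "x \<in> X" "f \<in> carrier (L_space (E x) (TE x))"
  shows "h_map X E H x f \<in> carrier (G_space X E H A)"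
proof -
  let ?L = "\<lambda>x. L_space (E x) (TE x)"
  have Hsub: "H \<subseteq> carrier (product_space X E)"
    using H_subspace by (simp add: submodule_def subgroup_def)
  have "can_inj X ?L x f \<in> A" using inj_in_A assms by blast
  moreover have "h_map X E H x f = restrict (theta X E (can_inj X ?L x f)) H"
    using Hsub by (auto simp: h_map_def theta_def can_inj_def Pr_def fun_eq_iff restrict_def
        L_space_def End_space_def product_space_def dest!: subsetD)
  ultimately show ?thesis by (auto simp: G_space_def)
qed

lemma ex1_G_topology: "\<exists>!T. is_final_lc_topology X \<tau> (G_space X E H A) (h_map X E H) T"
proof (rule ex1_final_lc_topology[OF G_vector_space])
  fix x assume x: "x \<in> X"
  then have "topspace (\<tau> x) = carrier (L_space (E x) (TE x))"
    using L_hlcs by (simp add: hlc_space_def lc_space_def)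
  then show "h_map X E H x ` topspace (\<tau> x) \<subseteq> carrier (G_space X E H A)"
    using h_map_in_G x by auto
qed

end

end

theory Submission
  imports Defs
begin

text \<open>
  By the universal property of the final locally convex topology, a linear map \<open>\<phi>\<close> on \<open>G\<close> is
  continuous as soon as every \<open>\<phi> \<circ> h\<^sub>x\<close> is: the topology pulled back along \<open>\<phi>\<close> is locally convex
  and makes every \<open>h\<^sub>x\<close> continuous, hence it is coarser than the final one. If \<open>\<phi>\<close> is the
  evaluation at \<open>v\<close>, then \<open>\<phi> \<circ> h\<^sub>x\<close> is the evaluation at \<open>v x\<close> followed by the continuous
  canonical injection.
\<close>

text \<open>Continuity into a pullback topology is tested after composing with \<phi>, and linearity
  of \<phi> carries the vector operations of \<open>V\<close> over to those of \<open>W\<close>.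
  Only \<open>lc_space\<close> is claimed: unless \<phi> is injective, the pulled-back topology need
  not be Hausdorff.\<close>

lemma lc_space_pullback:
  assumes V: "cvector_space V" and W: "lc_space W S"
    and closed: "\<And>a. a \<in> carrier V \<Longrightarrow> \<phi> a \<in> carrier W"
    and add: "\<And>a b. a \<in> carrier V \<Longrightarrow> b \<in> carrier V \<Longrightarrow> \<phi> (a \<oplus>\<^bsub>V\<^esub> b) = \<phi> a \<oplus>\<^bsub>W\<^esub> \<phi> b"
    and smult: "\<And>c a. a \<in> carrier V \<Longrightarrow> \<phi> (c \<odot>\<^bsub>V\<^esub> a) = c \<odot>\<^bsub>W\<^esub> \<phi> a"
  shows "lc_space V (pullback_topology (carrier V) \<phi> S)"
proof -
  interpret V: Module.module complex_ring V by (rule V)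
  interpret W: Module.module complex_ring W using W by (simp add: lc_space_def)
  note V_smult_closed = V.smult_closed[unfolded complex_ring_def, simplified]
  let ?T = "pullback_topology (carrier V) \<phi> S"
  have topS: "topspace S = carrier W"
    and addS: "continuous_map (prod_topology S S) S (\<lambda>(a, b). a \<oplus>\<^bsub>W\<^esub> b)"
    and smultS: "continuous_map (prod_topology euclidean S) S (\<lambda>(c, a). c \<odot>\<^bsub>W\<^esub> a)"
    and convexS: "\<And>U. openin S U \<Longrightarrow> \<zero>\<^bsub>W\<^esub> \<in> U \<Longrightarrow>
      \<exists>N C. openin S N \<and> \<zero>\<^bsub>W\<^esub> \<in> N \<and> N \<subseteq> C \<and> C \<subseteq> U \<and> convex_in W C"
    using W by (auto simp: lc_space_def)
  have topT: "topspace ?T = carrier V"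
    using closed by (auto simp: topspace_pullback_topology topS)
  have \<phi>: "continuous_map ?T S \<phi>"
    using continuous_map_pullback[OF continuous_map_id, of "carrier V" \<phi> S]
    by (simp add: o_def id_def)
  \<comment> \<open>Homogeneity with the scalar 0: both zero vectors are 0 times something.\<close>
  have zero: "\<phi> \<zero>\<^bsub>V\<^esub> = \<zero>\<^bsub>W\<^esub>"
    using smult[of "\<zero>\<^bsub>V\<^esub>" 0] V.smult_l_null[of "\<zero>\<^bsub>V\<^esub>"] W.smult_l_null[OF closed, of "\<zero>\<^bsub>V\<^esub>"]
    by (simp add: complex_ring_def)
  have "continuous_map (prod_topology ?T ?T) S (\<lambda>z. \<phi> (fst z) \<oplus>\<^bsub>W\<^esub> \<phi> (snd z))"
    using continuous_map_compose[OF continuous_map_pairedI addS,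
        of "prod_topology ?T ?T" "\<lambda>z. \<phi> (fst z)" "\<lambda>z. \<phi> (snd z)"]
      continuous_map_compose[OF continuous_map_fst \<phi>, of ?T]
      continuous_map_compose[OF continuous_map_snd \<phi>, of ?T]
    by (simp add: o_def)
  then have "continuous_map (prod_topology ?T ?T) S (\<phi> \<circ> (\<lambda>(a, b). a \<oplus>\<^bsub>V\<^esub> b))"
    by (rule continuous_map_eq) (auto simp: topT add)
  then have addT: "continuous_map (prod_topology ?T ?T) ?T (\<lambda>(a, b). a \<oplus>\<^bsub>V\<^esub> b)"
    by (rule continuous_map_pullback') (auto simp: topT)
  have "continuous_map (prod_topology euclidean ?T) S (\<lambda>z. fst z \<odot>\<^bsub>W\<^esub> \<phi> (snd z))"
    using continuous_map_compose[OF continuous_map_pairedI smultS,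
        of "prod_topology euclidean ?T" fst "\<lambda>z. \<phi> (snd z)"]
      continuous_map_compose[OF continuous_map_snd \<phi>, of euclidean]
    by (simp add: o_def continuous_map_fst)
  then have "continuous_map (prod_topology euclidean ?T) S (\<phi> \<circ> (\<lambda>(c, a). c \<odot>\<^bsub>V\<^esub> a))"
    by (rule continuous_map_eq) (auto simp: topT smult)
  then have smultT: "continuous_map (prod_topology euclidean ?T) ?T (\<lambda>(c, a). c \<odot>\<^bsub>V\<^esub> a)"
    by (rule continuous_map_pullback') (auto simp: topT V_smult_closed)
  have convexT: "\<exists>N C. openin ?T N \<and> \<zero>\<^bsub>V\<^esub> \<in> N \<and> N \<subseteq> C \<and> C \<subseteq> U \<and> convex_in V C"
    if U: "openin ?T U" "\<zero>\<^bsub>V\<^esub> \<in> U" for U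
  proof -
    obtain U' where U': "openin S U'" "U = \<phi> -` U' \<inter> carrier V"
      using U(1) by (auto simp: openin_pullback_topology)
    then obtain N C where "openin S N" "\<zero>\<^bsub>W\<^esub> \<in> N" "N \<subseteq> C" "C \<subseteq> U'" and C: "convex_in W C"
      using convexS[of U'] U(2) zero by auto
    \<comment> \<open>A linear preimage of a convex set is convex; the intersection is there because
      nothing is known about \<phi> off the carrier.\<close>
    moreover have "convex_in V (\<phi> -` C \<inter> carrier V)"
      using C by (auto simp: convex_in_def add smult V_smult_closed)
    moreover have "openin ?T (\<phi> -` N \<inter> carrier V)"
      using \<open>openin S N\<close> by (auto simp: openin_pullback_topology)
    ultimately show ?thesis
      using zero U'(2)
      by (intro exI[of _ "\<phi> -` N \<inter> carrier V"] exI[of _ "\<phi> -` C \<inter> carrier V"]) auto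
  qed
  show ?thesis
    unfolding lc_space_def using V topT addT smultT convexT by blast
qed

text \<open>Linearity of \<phi> makes the pulled-back topology a competitor in the maximality clause
  of \<open>is_final_lc_topology\<close>, so each of its open sets, in particular each preimage of
  an open set of \<open>S\<close>, is open in \<open>T\<close>.\<close>

lemma continuous_map_from_final_lc_topology:
  assumes T: "is_final_lc_topology I R V h T" and W: "lc_space W S"
    and closed: "\<And>a. a \<in> carrier V \<Longrightarrow> \<phi> a \<in> carrier W"
    and add: "\<And>a b. a \<in> carrier V \<Longrightarrow> b \<in> carrier V \<Longrightarrow> \<phi> (a \<oplus>\<^bsub>V\<^esub> b) = \<phi> a \<oplus>\<^bsub>W\<^esub> \<phi> b"
    and smult: "\<And>c a. a \<in> carrier V \<Longrightarrow> \<phi> (c \<odot>\<^bsub>V\<^esub> a) = c \<odot>\<^bsub>W\<^esub> \<phi> a"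
    and comp: "\<And>i. i \<in> I \<Longrightarrow> continuous_map (R i) S (\<phi> \<circ> h i)"
  shows "continuous_map T S \<phi>"
proof -
  let ?T = "pullback_topology (carrier V) \<phi> S"
  have V: "cvector_space V" and topT: "topspace T = carrier V"
    and hT: "\<And>i. i \<in> I \<Longrightarrow> continuous_map (R i) T (h i)"
    using T by (auto simp: is_final_lc_topology_def lc_space_def)
  have "lc_space V ?T"
    using V W closed add smult by (rule lc_space_pullback)
  moreover have "continuous_map (R i) ?T (h i)" if "i \<in> I" for i
    \<comment> \<open>Continuity of \<open>h i\<close> into \<open>T\<close> also shows that
      \<open>h i\<close> takes values in the carrier, as a map into the pullback must.\<close>
    using continuous_map_image_subset_topspace[OF hT[OF that]] topT
    by (intro continuous_map_pullback' comp that) auto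
  ultimately have finer: "openin ?T U \<Longrightarrow> openin T U" for U
    using T unfolding is_final_lc_topology_def by blast
  have "openin T (\<phi> -` U \<inter> topspace T)" if "openin S U" for U
    using that by (intro finer) (auto simp: openin_pullback_topology topT)
  moreover have "topspace S = carrier W" using W by (simp add: lc_space_def)
  ultimately show ?thesis
    using closed by (auto simp: continuous_map_alt topT)
qed

theorem lemma2p3p25:
  fixes X :: "'x set"
    and Y :: "'y topology"
    and \<mu> :: "('y \<Rightarrow> complex) \<Rightarrow> complex"
    and E :: "'x \<Rightarrow> (complex, 'e) module"
    and TE :: "'x \<Rightarrow> 'e topology"
    and PE :: "'x \<Rightarrow> ('e \<Rightarrow> real) set"
    and \<tau> :: "'x \<Rightarrow> ('e \<Rightarrow> 'e) topology"
    and PL :: "'x \<Rightarrow> (('e \<Rightarrow> 'e) \<Rightarrow> real) set"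
    and H :: "('x \<Rightarrow> 'e) set"
    and TH :: "('x \<Rightarrow> 'e) topology"
    and A :: "('x \<Rightarrow> 'e \<Rightarrow> 'e) set"
    and TG :: "(('x \<Rightarrow> 'e) \<Rightarrow> ('x \<Rightarrow> 'e)) topology"
    and D :: "('x \<Rightarrow> 'e) set"
  assumes data: "consistent_data X Y \<mu> E TE PE \<tau> PL H TH A"
    and TG: "is_final_lc_topology X \<tau> (G_space X E H A) (h_map X E H) TG"
    and D: "D \<subseteq> H"
    and A: "\<forall>x\<in>X. \<forall>vx\<in>Pr x ` D. continuous_map (\<tau> x) (TE x) (\<lambda>f. f vx)"
  shows "\<forall>v\<in>D. continuous_map TG TH (\<lambda>g. g v)"
proof
  fix v assume "v \<in> D"
  interpret consistent_data X Y \<mu> E TE PE \<tau> PL H TH A by (rule data)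
  have v: "v \<in> H" using D \<open>v \<in> D\<close> by blast
  have G: "g \<in> carrier (End_space HV)" if "g \<in> carrier (G_space X E H A)" for g
    using that theta_A by (auto simp: G_space_def L_space_def)
  show "continuous_map TG TH (\<lambda>g. g v)"
  proof (rule continuous_map_from_final_lc_topology[OF TG])
    show "lc_space HV TH" using H_hlcs by (simp add: hlc_space_def)
    show "g v \<in> carrier HV" if "g \<in> carrier (G_space X E H A)" for g
      using G[OF that] v by (auto simp: End_space_def)
  next
    fix x assume x: "x \<in> X"
    have "continuous_map (\<tau> x) (TE x) (\<lambda>f. f (v x))"
      using A x \<open>v \<in> D\<close> by (auto simp: Pr_def)
    then have "continuous_map (\<tau> x) TH (can_inj X E x \<circ> (\<lambda>f. f (v x)))"
      using inj_continuous[OF x] by (rule continuous_map_compose)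
    then show "continuous_map (\<tau> x) TH ((\<lambda>g. g v) \<circ> h_map X E H x)"
      \<comment> \<open>As \<open>v\<close> lies in \<open>H\<close>, the \<open>restrict\<close> in
        \<open>h_map\<close> disappears, and evaluating \<open>h_map X E H x f\<close> at
        \<open>v\<close> gives \<open>can_inj X E x (f (v x))\<close>.\<close>
      using v by (simp add: h_map_def o_def Pr_def)
  \<comment> \<open>What is left is linearity of the evaluation: the operations of
    \<open>G_space\<close> are those of \<open>End_space\<close>, hence pointwise on
    \<open>H\<close>.\<close>
  qed (use v in \<open>auto simp: G_space_def End_space_def\<close>)
qed

end
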